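(* Let $a\in\mathbb{C}$, let $h(x)=\frac{x^3}{3}+ax$, let $n\ge 0$ be an integer, and let $p(x)$ be a monic wave polynomial of degree $n$, satisfying $p''-h'p'+(nx+b)p=0$ with $b\in\mathbb{C}$. Let $A$ be the linear operator $$A=\frac{d^2}{dx^2}-h'(x)\frac{d}{dx}+nx$$ acting on the $(n+1)$-dimensional space $\mathbb{C}_n[x]$ of polynomials of degree at most $n$. Then $$p^2(-x)\ \sim\ \frac{c}{p^2(x)},\qquad c=\left.\left(\frac{d}{d\lambda}\det(A+\lambda)\right)\right|_{\lambda=b}.$$
   Context: A wave polynomial of degree $n$ is a nonzero polynomial $p(x)\in\mathbb{C}[x]$ for which there exists $b\in\mathbb{C}$ such that $y=p$ satisfies $y''(x)-h'(x)y'(x)+(nx+b)y(x)=0$; such a polynomial has degree exactly $n$ and only simple roots. Define the linear map $D:\mathbb{C}(x)\to\mathbb{C}(x)$ by $D(q)=q'+h'q$, and let $C=D(\mathbb{C}(x))$ be its image. For $q_1,q_2\in\mathbb{C}(x)$, write $q_1\sim q_2$ if and only if $q_1-q_2\in C$. Here $p^2(x)=(p(x))^2$ and $p^2(-x)=(p(-x))^2$. The operator $A$ preserves $\mathbb{C}_n[x]$; in the basis $e_k(x)=x^k/k!$, $k=0,\dots,n$ (with $e_{-1}=e_{-2}=0$), it is given by $Ae_k=e_{k-2}-ae_{k-1}+(n-k)(k+1)e_{k+1}$. In $\det(A+\lambda)$, $\lambda$ stands for $\lambda$ times the identity. *)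

theory Defs
  imports
    "HOL-Analysis.Derivative"
    "HOL-Computational_Algebra.Polynomial_Factorial"
    "Jordan_Normal_Form.Determinant"
begin

definition wave_h :: "complex \<Rightarrow> complex poly" where
  "wave_h a = [:0, a, 0, 1/3:]"

definition wave_eq :: "complex \<Rightarrow> nat \<Rightarrow> complex \<Rightarrow> complex poly \<Rightarrow> bool" where
  "wave_eq a n b y \<longleftrightarrow>
     pderiv (pderiv y) - pderiv (wave_h a) * pderiv y + [:b, of_nat n:] * y = 0"

definition wave_polynomial :: "complex \<Rightarrow> nat \<Rightarrow> complex poly \<Rightarrow> bool" where
  "wave_polynomial a n p \<longleftrightarrow> p \<noteq> 0 \<and> (\<exists>b. wave_eq a n b p)"

definition wave_op :: "complex \<Rightarrow> nat \<Rightarrow> complex poly \<Rightarrow> complex poly" where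
  "wave_op a n f = pderiv (pderiv f) - pderiv (wave_h a) * pderiv f + [:0, of_nat n:] * f"

definition exp_basis :: "nat \<Rightarrow> complex poly" where
  "exp_basis k = monom (1 / fact k) k"

text \<open>
  The determinant of an operator on the polynomials of degree at most \<open>n\<close>, computed from its
  matrix in the basis \<open>exp_basis 0, \<dots>, exp_basis n\<close>. The coordinate of \<open>f\<close> along
  \<open>exp_basis i\<close> is \<open>fact i * coeff f i\<close> (\<open>exp_basis_expansion\<close> below). This is meaningful only for
  operators that preserve the space; \<open>degree_wave_op_le\<close> shows that \<open>wave_op a n\<close> does.
\<close>

definition poly_op_mat :: "nat \<Rightarrow> (complex poly \<Rightarrow> complex poly) \<Rightarrow> complex mat" where
  "poly_op_mat n T =
     Matrix.mat (n + 1) (n + 1) (\<lambda>(i, j). fact i * coeff (T (exp_basis j)) i)"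

definition poly_op_det :: "nat \<Rightarrow> (complex poly \<Rightarrow> complex poly) \<Rightarrow> complex" where
  "poly_op_det n T = Determinant.det (poly_op_mat n T)"

lemma exp_basis_expansion:
  assumes "degree f \<le> n"
  shows "f = (\<Sum>i\<le>n. smult (fact i * coeff f i) (exp_basis i))"
proof -
  have "(\<Sum>i\<le>n. smult (fact i * coeff f i) (exp_basis i)) = (\<Sum>i\<le>n. monom (coeff f i) i)"
    by (simp add: exp_basis_def smult_monom)
  then show ?thesis
    using poly_as_sum_of_monoms'[OF assms] by simp
qed

lemma pderiv_wave_h: "pderiv (wave_h a) = [:a, 0, 1:]"
  by (simp add: wave_h_def pderiv_pCons)

lemma coeff_wave_op:
  "coeff (wave_op a n f) i =
     of_nat ((i + 1) * (i + 2)) * coeff f (i + 2) - a * (of_nat (i + 1) * coeff f (i + 1))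
     + (if i = 0 then 0 else (of_nat n - of_nat (i - 1)) * coeff f (i - 1))"
  by (cases i; cases "i - 1")
     (auto simp: wave_op_def pderiv_wave_h coeff_pderiv coeff_pCons algebra_simps)

lemma degree_wave_op_le:
  assumes "degree f \<le> n"
  shows "degree (wave_op a n f) \<le> n"
proof (rule degree_le, intro allI impI)
  fix i assume "n < i"
  moreover have "coeff f j = 0" if "j > n" for j
    using that assms by (simp add: coeff_eq_0)
  ultimately show "coeff (wave_op a n f) i = 0"
    by (cases "i - 1 = n") (auto simp: coeff_wave_op)
qed

lemma wave_op_exp_basis:
  assumes "k \<le> n"
  shows "wave_op a n (exp_basis k) =
    (if k \<ge> 2 then exp_basis (k - 2) else 0) - smult a (if k \<ge> 1 then exp_basis (k - 1) else 0)
    + smult (of_nat ((n - k) * (k + 1))) (exp_basis (k + 1))"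
proof (rule poly_eqI)
  fix i
  obtain m where n: "n = k + m"
    using assms by (auto simp: le_iff_add)
  define g :: "nat \<Rightarrow> complex" where "g j = 1 / fact j" for j
  have g: "g j = (1 + of_nat j) * g (Suc j)" for j
    using of_nat_neq_0[of j, where 'a = complex] by (simp add: g_def)
  have basis: "exp_basis j = monom (g j) j" for j
    by (simp add: exp_basis_def g_def)
  consider "k = i + 2" | "k = i + 1" | "i = k + 1" | "k \<noteq> i + 2" "k \<noteq> i + 1" "i \<noteq> k + 1"
    by blast
  then show "coeff (wave_op a n (exp_basis k)) i = coeff (
      (if k \<ge> 2 then exp_basis (k - 2) else 0) - smult a (if k \<ge> 1 then exp_basis (k - 1) else 0)
      + smult (of_nat ((n - k) * (k + 1))) (exp_basis (k + 1))) i"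
  proof cases
    case 1
    then show ?thesis
      using g[of i] g[of "Suc i"] by (auto simp: coeff_wave_op basis algebra_simps)
  next
    case 2
    then show ?thesis
      using g[of i] by (auto simp: coeff_wave_op basis algebra_simps)
  next
    case 3
    then show ?thesis
      using g[of k] by (auto simp: n coeff_wave_op basis algebra_simps)
  next
    case 4
    then show ?thesis
      by (auto simp: coeff_wave_op basis)
  qed
qed

text \<open>
  The quotient rule, by definite description because it must not depend on the representation
  \<open>u / v\<close> of the rational function; \<open>fract_deriv_Fract\<close> shows that it does not.
\<close>

definition fract_deriv :: "'a::field poly fract \<Rightarrow> 'a poly fract" where
  "fract_deriv q =
     (THE r. \<exists>u v. v \<noteq> 0 \<and> q = Fract u v \<and> r = Fract (pderiv u * v - u * pderiv v) (v\<^sup>2))"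

lemma fract_deriv_Fract:
  fixes u v :: "'a::field poly"
  assumes "v \<noteq> 0"
  shows "fract_deriv (Fract u v) = Fract (pderiv u * v - u * pderiv v) (v\<^sup>2)"
proof -
  have unique: "Fract (pderiv w * z - w * pderiv z) (z\<^sup>2) = Fract (pderiv u * v - u * pderiv v) (v\<^sup>2)"
    if "z \<noteq> 0" and quot: "Fract u v = Fract w z" for w z
  proof -
    have eq: "u * z = w * v"
      using assms that by (simp add: eq_fract)
    then have "pderiv (u * z) = pderiv (w * v)"
      by simp
    then have eq': "pderiv u * z = w * pderiv v + v * pderiv w - u * pderiv z"
      by (simp add: pderiv_mult algebra_simps)
    have "(pderiv u * v - u * pderiv v) * z\<^sup>2
        = v * z * (pderiv u * z) - pderiv v * z * (u * z)"
      by (simp add: power2_eq_square algebra_simps)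
    also have "\<dots> = v\<^sup>2 * z * pderiv w - v * pderiv z * (u * z)"
      unfolding eq' using eq by (simp add: power2_eq_square algebra_simps)
    also have "\<dots> = (pderiv w * z - w * pderiv z) * v\<^sup>2"
      using eq by (simp add: power2_eq_square algebra_simps)
    finally show ?thesis
      using assms that by (simp add: eq_fract)
  qed
  show ?thesis
    unfolding fract_deriv_def
    by (rule the_equality) (use assms unique in blast)+
qed

definition wave_D :: "complex \<Rightarrow> complex poly fract \<Rightarrow> complex poly fract" where
  "wave_D a q = fract_deriv q + to_fract (pderiv (wave_h a)) * q"

definition wave_sim :: "complex \<Rightarrow> complex poly fract \<Rightarrow> complex poly fract \<Rightarrow> bool" where
  "wave_sim a q\<^sub>1 q\<^sub>2 \<longleftrightarrow> q\<^sub>1 - q\<^sub>2 \<in> range (wave_D a)"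

end

theory Submission
  imports Defs
    "HOL-Computational_Algebra.Field_as_Ring"
    "HOL-Computational_Algebra.Fundamental_Theorem_Algebra"
begin

text \<open>
  A second solution of the wave equation is \<open>y = p \<integral> exp h / p\<^sup>2\<close>. Differentiating \<open>n + 1\<close> times
  turns the equation into one satisfied by \<open>exp h\<close> times \<open>p(-x)\<close>, and this forces the
  \<open>(n + 1)\<close>-st derivative of \<open>y\<close> to be \<open>(-1) ^ n p(-x) exp h\<close>. Repeated integration by parts of
  \<open>p(-x)\<close> against this derivative ends with the \<open>(n + 1)\<close>-st derivative of \<open>p(-x)\<close>, which vanishes;
  what remains is a rational multiple of \<open>exp h\<close> plus a constant multiple of \<open>\<integral> exp h / p\<^sup>2\<close>.
  The constant is \<open>(-1) ^ n\<close> times the pairing of the coordinate vector of \<open>p\<close> with its reversal.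
  The matrix of the operator is Hessenberg and symmetric about its antidiagonal, so these two
  vectors span the right and left kernels at \<open>\<lambda> = b\<close>, and their pairing is, up to the same sign,
  the derivative of the determinant.
\<close>

section \<open>Derivations of the field of rational functions\<close>

lemma fract_deriv_to_fract [simp]: "fract_deriv (to_fract u) = to_fract (pderiv u)"
  for u :: "'a::field poly"
  by (simp add: to_fract_def fract_deriv_Fract)

lemma fract_deriv_add: "fract_deriv (q + r) = fract_deriv q + fract_deriv r"
  for q r :: "'a::field poly fract"
proof (cases q)
  case q: (Fract u v)
  show ?thesis
  proof (cases r)
    case r: (Fract w z)
    show ?thesis
      using q r
      by (simp add: fract_deriv_Fract eq_fract pderiv_add pderiv_mult)
        (simp add: power2_eq_square algebra_simps)
  qed
qed

lemma fract_deriv_mult: "fract_deriv (q * r) = fract_deriv q * r + q * fract_deriv r"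
  for q r :: "'a::field poly fract"
proof (cases q)
  case q: (Fract u v)
  show ?thesis
  proof (cases r)
    case r: (Fract w z)
    show ?thesis
      using q r
      by (simp add: fract_deriv_Fract eq_fract pderiv_mult)
        (simp add: power2_eq_square algebra_simps)
  qed
qed

lemma fract_deriv_0 [simp]: "fract_deriv (0 :: 'a::field poly fract) = 0"
  using fract_deriv_to_fract[of 0] by simp

lemma fract_deriv_1 [simp]: "fract_deriv (1 :: 'a::field poly fract) = 0"
  using fract_deriv_to_fract[of 1] by simp

lemma fract_deriv_minus: "fract_deriv (- q) = - fract_deriv q"
  for q :: "'a::field poly fract"
  using fract_deriv_add[of q "- q"] by (simp add: eq_neg_iff_add_eq_0 add.commute)

lemma fract_deriv_diff: "fract_deriv (q - r) = fract_deriv q - fract_deriv r"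
  for q r :: "'a::field poly fract"
  using fract_deriv_add[of q "- r"] by (simp add: fract_deriv_minus)

lemma fract_deriv_of_nat [simp]: "fract_deriv (of_nat k :: 'a::field poly fract) = 0"
  by (induction k) (simp_all add: fract_deriv_add)

lemma fract_deriv_sum: "fract_deriv (\<Sum>x\<in>A. f x) = (\<Sum>x\<in>A. fract_deriv (f x))"
  for f :: "'b \<Rightarrow> 'a::field poly fract"
  by (induction A rule: infinite_finite_induct) (simp_all add: fract_deriv_add)

lemma fract_deriv_inverse: "fract_deriv (inverse q) = - fract_deriv q / q\<^sup>2"
  for q :: "'a::field poly fract"
proof (cases "q = 0")
  case False
  then have "fract_deriv q * inverse q + q * fract_deriv (inverse q) = 0"
    using fract_deriv_mult[of q "inverse q"] by simp
  with False show ?thesis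
    by (simp add: field_simps power2_eq_square add_eq_0_iff)
qed simp

lemma to_fract_of_nat: "to_fract (of_nat k) = of_nat k"
  by (induction k) simp_all

lemma to_fract_numeral: "to_fract (numeral k) = numeral k"
  by (metis of_nat_numeral to_fract_of_nat)

lemma to_fract_power: "to_fract (q ^ k) = to_fract q ^ k"
  by (induction k) simp_all

lemma wave_D_sum: "wave_D a (\<Sum>x\<in>A. f x) = (\<Sum>x\<in>A. wave_D a (f x))"
  by (simp add: wave_D_def fract_deriv_sum sum.distrib sum_distrib_left)

section \<open>Rational solutions of linear differential equations\<close>

text \<open>The factor \<open>l\<close> keeps the exponent at \<open>m\<close>, avoiding a truncated
  \<open>m - 1\<close>. It serves first for the denominator at a pole, then for \<open>l\<close>
  times its derivative.\<close>

lemma pderiv_linear_power_mult: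
  fixes l t :: "'a::idom poly"
  assumes "pderiv l = 1"
  shows "l * pderiv (l ^ m * t) = l ^ m * (of_nat m * t + l * pderiv t)"
proof -
  have "l * pderiv (l ^ m) = of_nat m * l ^ m"
    unfolding pderiv_power assms by (cases m) (simp_all add: of_nat_poly)
  moreover have "l * pderiv (l ^ m * t) = (l * pderiv (l ^ m)) * t + l ^ m * (l * pderiv t)"
    by (simp add: pderiv_mult algebra_simps)
  ultimately show ?thesis
    by (simp add: algebra_simps)
qed

text \<open>At a pole of order \<open>m\<close>, the pole of order \<open>m + 2\<close> of \<open>w''\<close> has the nonzero
  coefficient \<open>m (m + 1)\<close>, and no other term has a pole of that order.\<close>
lemma rational_solution_is_polynomial:
  fixes w :: "complex poly fract"
  assumes ode: "fract_deriv (fract_deriv w) + to_fract f * fract_deriv w + to_fract g * w = 0"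
  obtains W where "w = to_fract W"
proof -
  define u where "u = fst (quot_of_fract w)"
  define v where "v = snd (quot_of_fract w)"
  have v0: "v \<noteq> 0" and cop: "coprime u v"
    unfolding u_def v_def by (simp_all add: coprime_quot_of_fract)
  have w: "to_fract v * w = to_fract u"
    using v0 Fract_quot_of_fract[of w] unfolding u_def v_def
    by (metis Fract_conv_to_fract nonzero_mult_div_cancel_left times_divide_eq_right to_fract_eq_0_iff)
  have "degree v = 0"
  proof (rule ccontr)
    assume "degree v \<noteq> 0"
    then have "\<not> constant (poly v)"
      by (simp add: constant_degree)
    then obtain z where z: "poly v z = 0"
      using fundamental_theorem_of_algebra by blast
    define l where "l = [:- z, 1:]"
    define m where "m = order z v"
    obtain t where v: "v = l ^ m * t" and "\<not> l dvd t"
      using order_decomp[OF v0, of z] unfolding l_def m_def by blast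
    then have t: "poly t z \<noteq> 0"
      by (simp add: l_def poly_eq_0_iff_dvd)
    have l: "poly l z = 0" "pderiv l = 1"
      by (simp_all add: l_def pderiv_pCons)
    have m: "m \<noteq> 0"
      using z v0 by (simp add: m_def order_root)
    have u: "poly u z \<noteq> 0"
      using coprime_poly_0[OF cop, of z] z by simp
    \<comment> \<open>Up to the factor \<open>l ^ m\<close>, \<open>\<alpha>\<close> and
      \<open>\<beta>\<close> are the first and second derivatives of \<open>v\<close> times
      \<open>l\<close> and \<open>l * l\<close>; \<open>\<gamma>\<close> is the derivative of
      \<open>w\<close> times \<open>l * t * v\<close>.\<close>
    define \<alpha> where "\<alpha> = of_nat m * t + l * pderiv t"
    define \<beta> where "\<beta> = of_nat m * \<alpha> + l * pderiv \<alpha> - \<alpha>"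
    define \<gamma> where "\<gamma> = l * t * pderiv u - \<alpha> * u"
    have v1: "l * pderiv v = l ^ m * \<alpha>"
      using pderiv_linear_power_mult[OF l(2)] by (simp add: v \<alpha>_def)
    have "pderiv v + l * pderiv (pderiv v) = pderiv (l ^ m * \<alpha>)"
      using arg_cong[OF v1, of pderiv] l(2) by (simp add: pderiv_mult add.commute)
    then have "l * pderiv v + l * l * pderiv (pderiv v) = l ^ m * (of_nat m * \<alpha> + l * pderiv \<alpha>)"
      using pderiv_linear_power_mult[OF l(2), of m \<alpha>] by (metis distrib_left mult.assoc)
    then have v2: "l * l * pderiv (pderiv v) = l ^ m * \<beta>"
      using v1 by (simp add: \<beta>_def algebra_simps)
    define w1 where "w1 = fract_deriv w"
    define w2 where "w2 = fract_deriv w1"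
    have u1: "to_fract (pderiv u) = to_fract (pderiv v) * w + to_fract v * w1"
      using arg_cong[OF w, of fract_deriv] by (simp add: fract_deriv_mult w1_def)
    have u2: "to_fract (pderiv (pderiv u)) =
        to_fract (pderiv (pderiv v)) * w + 2 * (to_fract (pderiv v) * w1) + to_fract v * w2"
      using arg_cong[OF u1, of fract_deriv]
      by (simp add: fract_deriv_mult fract_deriv_add w1_def w2_def)
    define L R V where "L = to_fract l" and "R = to_fract t" and "V = to_fract v"
    have V: "V = L ^ m * R"
      by (simp add: V_def L_def R_def v to_fract_power)
    have "L * to_fract (pderiv v) = L ^ m * to_fract \<alpha>"
      using arg_cong[OF v1, of to_fract] by (simp only: L_def to_fract_mult to_fract_power)
    then have k1: "L * R * to_fract (pderiv v) = to_fract \<alpha> * V"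
      by (simp add: V mult.assoc mult.left_commute[of _ R])
    have "L * L * to_fract (pderiv (pderiv v)) = L ^ m * to_fract \<beta>"
      using arg_cong[OF v2, of to_fract] by (simp only: L_def to_fract_mult to_fract_power)
    then have k2: "L * L * R * to_fract (pderiv (pderiv v)) = to_fract \<beta> * V"
      by (simp add: V mult.assoc mult.left_commute[of _ R])
    have "to_fract \<gamma> = L * R * to_fract (pderiv u) - to_fract \<alpha> * to_fract u"
      by (simp add: \<gamma>_def L_def R_def)
    also have "\<dots> = L * R * (V * w1)"
      using k1 by (simp add: u1 w[symmetric] V_def algebra_simps)
    finally have c: "to_fract \<gamma> = L * R * V * w1"
      by (simp add: mult.assoc)
    \<comment> \<open>The equation is multiplied by \<open>l * l * t * t * v\<close> to clear
      denominators. At \<open>z\<close> only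
      \<open>- 2 * \<alpha> * \<gamma> - t * \<beta> * u\<close> survives, with
      \<open>\<alpha> = m t\<close>, \<open>\<beta> = m (m - 1) t\<close> and
      \<open>\<gamma> = - m t u\<close>.\<close>
    have "to_fract (l * l * t * t * pderiv (pderiv u) - 2 * \<alpha> * \<gamma> - t * \<beta> * u
        + f * l * t * \<gamma> + g * l * l * t * t * u)
        = R * w * (L * L * R * to_fract (pderiv (pderiv v)))
          + 2 * L * R * w1 * (L * R * to_fract (pderiv v)) + L * L * R * R * V * w2
          - 2 * to_fract \<alpha> * to_fract \<gamma> - R * to_fract \<beta> * V * w
          + to_fract f * L * R * to_fract \<gamma> + to_fract g * L * L * R * R * V * w"
      by (simp add: u2 w[symmetric] L_def R_def V_def to_fract_numeral algebra_simps)
    also have "\<dots> = L * L * R * R * V * (w2 + to_fract f * w1 + to_fract g * w)"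
      unfolding k1 k2 c by (simp add: algebra_simps)
    also have "\<dots> = 0"
      using ode by (simp add: w1_def w2_def)
    finally have "to_fract (l * l * t * t * pderiv (pderiv u) - 2 * \<alpha> * \<gamma> - t * \<beta> * u
        + f * l * t * \<gamma> + g * l * l * t * t * u) = 0" .
    then have "l * l * t * t * pderiv (pderiv u) - 2 * \<alpha> * \<gamma> - t * \<beta> * u
        + f * l * t * \<gamma> + g * l * l * t * t * u = 0"
      by (simp only: to_fract_eq_0_iff)
    from arg_cong[OF this, of "\<lambda>q. poly q z"]
    have "of_nat m * (of_nat m + 1) * poly t z * poly t z * poly u z = 0"
      by (simp add: l(1) \<alpha>_def \<beta>_def \<gamma>_def algebra_simps)
    then show False
      using m t u by (metis mult_eq_0_iff of_nat_Suc of_nat_eq_0_iff nat.simps(3) add.commute)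
  qed
  then obtain d where d: "v = [:d:]"
    by (rule degree_eq_zeroE)
  have "to_fract [:1 / d:] * to_fract v = 1"
    using v0 by (simp add: d flip: to_fract_mult one_pCons)
  then have "w = to_fract ([:1 / d:] * u)"
    unfolding to_fract_mult w[symmetric] by (simp flip: mult.assoc)
  then show thesis
    by (rule that)
qed

section \<open>The second solution of the wave equation\<close>

lemma higher_pderiv_wave_h: "pderiv (pderiv (wave_h a)) = 2 * [:0, 1:]"
  by (simp add: pderiv_wave_h pderiv_pCons numeral_poly)

text \<open>The \<open>k\<close>-th derivative of the wave equation, in terms of the successive derivatives
  \<open>y\<close> of the solution. At \<open>k = 0\<close> the truncated index \<open>k - 1\<close> has the factor \<open>0\<close>.\<close>
definition wave_rec :: "complex \<Rightarrow> nat \<Rightarrow> complex \<Rightarrow> (nat \<Rightarrow> complex poly fract) \<Rightarrow> nat \<Rightarrow> complex poly fract"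
  where "wave_rec a n b y k =
    y (k + 2) - to_fract (pderiv (wave_h a)) * y (k + 1)
    + (to_fract [:b:] + (of_nat n - 2 * of_nat k) * to_fract [:0, 1:]) * y k
    + of_nat k * (of_nat n - of_nat k + 1) * y (k - 1)"

text \<open>Differentiating the relation at \<open>k\<close> gives the one at \<open>k + 1\<close>,
  up to multiples of relations already known. The case \<open>G = 0\<close>, \<open>g = 0\<close>
  covers the derivatives of \<open>p\<close>; the case \<open>G = h'\<close>, with
  \<open>g k\<close> the \<open>k\<close>-th derivative of \<open>p\<close> over \<open>p^2\<close>,
  covers the remainders.\<close>

lemma wave_rec_eq_0:
  assumes y: "\<And>k. fract_deriv (y k) = y (Suc k) - G * y k - g k"
    and g: "\<And>k. wave_rec a n b g k = 0"
    and y0: "wave_rec a n b y 0 = 0"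
  shows "wave_rec a n b y k = 0"
proof (induction k)
  case (Suc k)
  define X where "X = to_fract [:0, 1 :: complex:]"
  have X: "fract_deriv X = 1"
    by (simp add: X_def pderiv_pCons flip: one_pCons)
  have B: "fract_deriv (to_fract [:b:]) = 0"
    by (simp add: pderiv_pCons)
  have H: "fract_deriv (to_fract (pderiv (wave_h a))) = 2 * X"
    by (simp only: fract_deriv_to_fract higher_pderiv_wave_h to_fract_mult to_fract_numeral X_def)
  have two: "fract_deriv (2 :: complex poly fract) = 0"
    using fract_deriv_of_nat[of 2] by simp
  \<comment> \<open>For \<open>k = 0\<close> the hypothesis on \<open>y\<close> would produce
    \<open>y 1\<close> instead of \<open>y 0\<close>, but the factor \<open>of_nat k\<close> kills
    both sides.\<close>
  have last: "of_nat k * (of_nat n - of_nat k + 1) * fract_deriv (y (k - 1))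
      = of_nat k * (of_nat n - of_nat k + 1) * (y k - G * y (k - 1) - g (k - 1))"
    by (cases k) (simp_all add: y)
  have "fract_deriv (wave_rec a n b y k) =
      y (k + 3) - G * y (k + 2) - g (k + 2)
      - (2 * X * y (k + 1)
         + to_fract (pderiv (wave_h a)) * (y (k + 2) - G * y (k + 1) - g (k + 1)))
      + ((of_nat n - 2 * of_nat k) * y k
         + (to_fract [:b:] + (of_nat n - 2 * of_nat k) * X) * (y (k + 1) - G * y k - g k))
      + of_nat k * (of_nat n - of_nat k + 1) * fract_deriv (y (k - 1))"
    unfolding wave_rec_def X_def[symmetric]
    by (simp add: fract_deriv_add fract_deriv_diff fract_deriv_mult X B H two y numeral_3_eq_3
      del: fract_deriv_to_fract)
  \<comment> \<open>The coefficients of \<open>y k\<close> agree because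
    \<open>(n - 2 k) + k (n - k + 1) = (k + 1) (n - k)\<close>.\<close>
  also have "\<dots> = wave_rec a n b y (Suc k) - G * wave_rec a n b y k - wave_rec a n b g k"
    unfolding last wave_rec_def X_def[symmetric]
    by (simp add: numeral_3_eq_3 algebra_simps)
  finally show ?case
    using Suc g by simp
qed (rule y0)

text \<open>The \<open>k\<close>-th derivative of \<open>p \<integral> exp h / p\<^sup>2\<close> is
  \<open>(pderiv ^^ k) p \<integral> exp h / p\<^sup>2 + wave_rem a p k exp h\<close>.\<close>
primrec wave_rem :: "complex \<Rightarrow> complex poly \<Rightarrow> nat \<Rightarrow> complex poly fract" where
  "wave_rem a p 0 = 0"
| "wave_rem a p (Suc k) = wave_D a (wave_rem a p k) + to_fract ((pderiv ^^ k) p) / to_fract (p\<^sup>2)"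

lemma wave_rec_divide: "wave_rec a n b (\<lambda>k. y k / q) k = wave_rec a n b y k / q"
  by (simp add: wave_rec_def algebra_simps add_divide_distrib diff_divide_distrib)

lemma wave_rec_higher_pderiv:
  assumes "wave_eq a n b p"
  shows "wave_rec a n b (\<lambda>k. to_fract ((pderiv ^^ k) p)) k = 0"
proof (rule wave_rec_eq_0[where G = 0 and g = "\<lambda>_. 0"])
  have "[:b, of_nat n:] = [:b:] + of_nat n * [:0, 1:]"
    by (simp add: of_nat_poly)
  then have "to_fract (pderiv (pderiv p) - pderiv (wave_h a) * pderiv p
      + ([:b:] + of_nat n * [:0, 1:]) * p) = 0"
    using assms by (simp add: wave_eq_def)
  then show "wave_rec a n b (\<lambda>k. to_fract ((pderiv ^^ k) p)) 0 = 0"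
    by (simp only: to_fract_add to_fract_diff to_fract_mult to_fract_of_nat wave_rec_def)
      (simp add: eval_nat_numeral)
qed (simp_all add: wave_rec_def)

lemma wave_rem_1: "wave_rem a p (Suc 0) = 1 / to_fract p"
  by (simp add: wave_D_def power2_eq_square)

lemma wave_rec_wave_rem:
  assumes "wave_eq a n b p" and "p \<noteq> 0"
  shows "wave_rec a n b (wave_rem a p) k = 0"
proof (rule wave_rec_eq_0[where G = "to_fract (pderiv (wave_h a))"])
  show "fract_deriv (wave_rem a p k) = wave_rem a p (Suc k)
      - to_fract (pderiv (wave_h a)) * wave_rem a p k
      - to_fract ((pderiv ^^ k) p) / to_fract (p\<^sup>2)" for k
    by (simp add: wave_D_def)
  show "wave_rec a n b (\<lambda>k. to_fract ((pderiv ^^ k) p) / to_fract (p\<^sup>2)) k = 0" for k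
    by (simp add: wave_rec_divide wave_rec_higher_pderiv assms)
  have "wave_rem a p (Suc (Suc 0)) = wave_D a (1 / to_fract p) + to_fract (pderiv p) / to_fract (p\<^sup>2)"
    using wave_rem_1[of a p] by (simp only: wave_rem.simps funpow.simps o_apply id_apply)
  \<comment> \<open>The derivative of \<open>1 / p\<close> cancels \<open>p' / p^2\<close>.\<close>
  also have "\<dots> = to_fract (pderiv (wave_h a)) * wave_rem a p (Suc 0)"
    unfolding wave_rem_1 using fract_deriv_inverse[of "to_fract p"]
    by (simp add: wave_D_def power2_eq_square inverse_eq_divide)
  finally show "wave_rec a n b (wave_rem a p) 0 = 0"
    by (simp add: wave_rec_def eval_nat_numeral del: wave_rem.simps(2))
qed

section \<open>Degree and uniqueness of polynomial solutions\<close>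

lemma degree_wave_eq:
  assumes "wave_eq a n b y" and "y \<noteq> 0"
  shows "degree y = n"
proof -
  have "wave_op a n y + smult b y = 0"
    using assms(1) by (simp add: wave_eq_def wave_op_def algebra_simps)
  \<comment> \<open>Only the term \<open>x^2\<close> of \<open>h'\<close> and the term
    \<open>n x\<close> reach this degree.\<close>
  then have "coeff (wave_op a n y + smult b y) (Suc (degree y)) = 0"
    by simp
  then have "(of_nat n - of_nat (degree y)) * lead_coeff y = 0"
    by (simp add: coeff_wave_op coeff_eq_0)
  with assms(2) show ?thesis
    by simp
qed

text \<open>The difference solves the same equation, so if nonzero it would have degree
  \<open>n\<close>, but its coefficient there vanishes.\<close>

lemma wave_eq_unique:
  assumes "wave_eq a n b p" and "wave_eq a n b y" and "coeff y n = coeff p n"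
  shows "y = p"
proof (rule ccontr)
  assume "y \<noteq> p"
  moreover have "wave_eq a n b (y - p)"
  proof -
    have *: "(x - x') - (y - y') + (z - z') = (x - y + z) - (x' - y' + z')" for x x' y y' z z' :: "complex poly"
      by simp
    show ?thesis
      using assms(1,2) unfolding wave_eq_def pderiv_diff right_diff_distrib *
      by (simp del: mult_pCons_left)
  qed
  ultimately have "degree (y - p) = n"
    by (intro degree_wave_eq) simp_all
  then have "lead_coeff (y - p) = 0"
    using assms(3) by simp
  with \<open>y \<noteq> p\<close> show False
    by (metis leading_coeff_0_iff right_minus_eq)
qed

lemma wave_eq_smult: "wave_eq a n b y \<Longrightarrow> wave_eq a n b (smult c y)"
  unfolding wave_eq_def pderiv_smult
  by (metis mult_smult_right smult_0_right smult_add_right smult_diff_right)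

lemma higher_pderiv_degree_Suc: "degree p \<le> n \<Longrightarrow> (pderiv ^^ Suc n) p = 0"
  for p :: "complex poly"
  by (rule poly_eqI) (simp add: coeff_higher_pderiv coeff_eq_0 del: funpow.simps)

text \<open>This records the growth \<open>x^(2 k - n)\<close> of
  \<open>wave_rem a p (Suc k)\<close> at infinity: each \<open>wave_D\<close> is dominated by
  multiplication by \<open>h'\<close>, monic of degree 2. At \<open>k = n\<close> it fixes the
  degree and leading coefficient of the remainder once that is known to be a polynomial.\<close>

lemma wave_rem_denominator:
  assumes p: "wave_eq a n b p" "lead_coeff p = 1"
  shows "\<exists>s. wave_rem a p (Suc k) * to_fract (p ^ Suc k) = to_fract s
    \<and> degree s = (n + 2) * k \<and> lead_coeff s = 1"
proof (induction k)
  case 0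
  from p(2) have "p \<noteq> 0"
    by auto
  then show ?case
    unfolding wave_rem_1 by (intro exI[of _ 1]) simp
next
  case (Suc k)
  from p(2) have p0: "p \<noteq> 0"
    by auto
  with p have deg: "degree p = n"
    by (intro degree_wave_eq)
  obtain s where s: "wave_rem a p (Suc k) * to_fract (p ^ Suc k) = to_fract s"
      "degree s = (n + 2) * k" "lead_coeff s = 1"
    using Suc by blast
  \<comment> \<open>The next numerator, over \<open>p ^ (k + 2)\<close>, is \<open>d + m\<close>.
    The part \<open>m\<close> comes from \<open>h'\<close>, and its degree exceeds the bound for
    \<open>d\<close> by 2.\<close>
  define d where "d = pderiv s * p - of_nat (Suc k) * pderiv p * s + (pderiv ^^ Suc k) p * p ^ k"
  define m where "m = pderiv (wave_h a) * (p * s)"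
  have s0: "s \<noteq> 0"
    using s(3) by auto
  have h: "degree (pderiv (wave_h a)) = 2" "lead_coeff (pderiv (wave_h a)) = 1"
    by (simp_all add: pderiv_wave_h)
  have dm: "degree m = (n + 2) * Suc k"
    unfolding m_def using h(1) s0 p0 s(2) deg by (subst degree_mult_eq) (auto simp: degree_mult_eq)
  have lm: "lead_coeff m = 1"
    unfolding m_def using h s p by (simp only: lead_coeff_mult mult_1_left)
  have "degree d \<le> (n + 2) * k + n"
    unfolding d_def
  proof (intro degree_add_le degree_diff_le)
    show "degree (pderiv s * p) \<le> (n + 2) * k + n"
      using degree_mult_le[of "pderiv s" p] s(2) deg by (simp add: degree_pderiv)
    show "degree (of_nat (Suc k) * pderiv p * s) \<le> (n + 2) * k + n"
      using degree_mult_le[of "of_nat (Suc k) * pderiv p" s]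
        degree_mult_le[of "of_nat (Suc k)" "pderiv p"] s(2) deg
      by (simp add: degree_pderiv del: of_nat_Suc)
    show "degree ((pderiv ^^ Suc k) p * p ^ k) \<le> (n + 2) * k + n"
      using degree_mult_le[of "(pderiv ^^ Suc k) p" "p ^ k"] degree_power_le[of p k] deg
      by (simp add: degree_higher_pderiv del: funpow.simps)
  qed
  then have "degree d < degree m"
    by (simp add: dm)
  then have "degree (d + m) = (n + 2) * Suc k" "lead_coeff (d + m) = 1"
    using dm lm by (simp_all add: degree_add_eq_right coeff_eq_0)
  moreover have "wave_rem a p (Suc (Suc k)) * to_fract (p ^ Suc (Suc k)) = to_fract (d + m)"
  proof -
    define P R where "P = to_fract p" and "R = wave_rem a p (Suc k)"
    have P: "P \<noteq> 0" using p0 by (simp add: P_def)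
    have s1: "to_fract s = R * P ^ Suc k"
      using s(1) by (simp only: R_def P_def to_fract_power)
    have p': "pderiv (p ^ Suc k) = of_nat (Suc k) * p ^ k * pderiv p"
      by (simp only: pderiv_power_Suc of_nat_poly) simp
    have "fract_deriv (P ^ Suc k) = of_nat (Suc k) * P ^ k * to_fract (pderiv p)"
      unfolding P_def to_fract_power[symmetric] fract_deriv_to_fract p'
      by (simp only: to_fract_mult to_fract_of_nat)
    then have s2: "to_fract (pderiv s) = fract_deriv R * P ^ Suc k
        + R * (of_nat (Suc k) * P ^ k * to_fract (pderiv p))"
      using arg_cong[OF s1, of fract_deriv] by (simp only: fract_deriv_mult fract_deriv_to_fract)
    have "wave_rem a p (Suc (Suc k)) * to_fract (p ^ Suc (Suc k)) =
      (fract_deriv R + to_fract (pderiv (wave_h a)) * R) * P ^ Suc (Suc k)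
        + to_fract ((pderiv ^^ Suc k) p) / P\<^sup>2 * P ^ Suc (Suc k)"
      unfolding wave_rem.simps(2)[of a p "Suc k"] wave_D_def R_def[symmetric] to_fract_power P_def[symmetric]
      by (simp only: distrib_right)
    also have "to_fract ((pderiv ^^ Suc k) p) / P\<^sup>2 * P ^ Suc (Suc k)
        = to_fract ((pderiv ^^ Suc k) p) * P ^ k"
      using P by (simp add: power2_eq_square)
    also have "(fract_deriv R + to_fract (pderiv (wave_h a)) * R) * P ^ Suc (Suc k) + \<dots>
      = to_fract (d + m)"
      unfolding d_def m_def to_fract_add to_fract_diff to_fract_mult to_fract_power to_fract_of_nat
        s1 s2 P_def[symmetric]
      by (simp add: algebra_simps)
    finally show ?thesis .
  qed
  ultimately show ?case
    by metis
qed

text \<open>After the reflection \<open>x \<mapsto> -x\<close>, the left-hand side solves the wave equation again, so that it is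
  determined by its leading coefficient.\<close>
lemma wave_rem_Suc_degree:
  assumes p: "wave_eq a n b p" "lead_coeff p = 1"
  shows "wave_rem a p (Suc n) = to_fract (smult ((-1) ^ n) (pcompose p [:0, -1:]))"
proof -
  from p(2) have p0: "p \<noteq> 0"
    by auto
  with p have deg: "degree p = n"
    by (intro degree_wave_eq)
  define w where "w = wave_rem a p (Suc n)"
  define H where "H = to_fract (pderiv (wave_h a))"
  define m where "m = [:0, - 1 :: complex:]"
  define X where "X = to_fract [:0, 1 :: complex:]"
  have P0: "(pderiv ^^ Suc n) p = 0"
    using deg by (simp add: higher_pderiv_degree_Suc del: funpow.simps)
  then have P1: "(pderiv ^^ Suc (Suc n)) p = 0"
    by simp
  have w1: "wave_rem a p (n + 2) = fract_deriv w + H * w"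
    using P0 by (simp add: w_def H_def wave_D_def del: funpow.simps)
  have w2: "wave_rem a p (n + 3) = wave_D a (wave_rem a p (n + 2))"
    using P1 by (simp add: numeral_3_eq_3 del: funpow.simps)
  \<comment> \<open>At \<open>k = n + 1\<close> the factor \<open>n - k + 1\<close> vanishes, so
    \<open>wave_rem a p n\<close> drops out. The two later remainders are iterated
    \<open>wave_D\<close> images of \<open>w\<close>, which leaves a second-order equation for
    \<open>w\<close> alone.\<close>
  have "wave_rec a n b (wave_rem a p) (Suc n) = 0"
    using p(1) p0 by (rule wave_rec_wave_rem)
  moreover have "wave_rec a n b (wave_rem a p) (Suc n) = wave_rem a p (n + 3) - H * wave_rem a p (n + 2)
      + (to_fract [:b:] - (of_nat n + 2) * X) * w"
    by (simp add: wave_rec_def H_def X_def w_def numeral_3_eq_3 algebra_simps del: wave_rem.simps)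
  ultimately have "wave_D a (fract_deriv w + H * w) - H * (fract_deriv w + H * w)
      + (to_fract [:b:] - (of_nat n + 2) * X) * w = 0"
    unfolding w2 w1 by simp
  \<comment> \<open>The second derivative \<open>2 x\<close> of \<open>h\<close> turns
    \<open>- (n + 2) x\<close> into \<open>- n x\<close>.\<close>
  then have ode: "fract_deriv (fract_deriv w) + to_fract (pderiv (wave_h a)) * fract_deriv w
      + to_fract ([:b:] - of_nat n * [:0, 1:]) * w = 0"
    by (simp only: wave_D_def H_def fract_deriv_add fract_deriv_mult fract_deriv_to_fract
        higher_pderiv_wave_h to_fract_diff to_fract_mult to_fract_numeral to_fract_of_nat X_def)
      (simp add: algebra_simps)
  then obtain W where W: "w = to_fract W"
    by (rule rational_solution_is_polynomial)
  \<comment> \<open>Since \<open>h'\<close> is even, reflection only flips the signs of the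
    first-derivative term and of \<open>n x\<close>.\<close>
  define y where "y = pcompose W m"
  have m: "pderiv m = - 1" "pcompose m m = [:0, 1:]"
    by (simp_all add: m_def pderiv_pCons pcompose_pCons one_pCons)
  have "to_fract (pderiv (pderiv W) + pderiv (wave_h a) * pderiv W
      + ([:b:] - of_nat n * [:0, 1:]) * W) = 0"
    using ode by (simp only: W fract_deriv_to_fract to_fract_add to_fract_mult)
  then have "pderiv (pderiv W) + pderiv (wave_h a) * pderiv W
      + ([:b:] - of_nat n * [:0, 1:]) * W = 0"
    by (simp only: to_fract_eq_0_iff)
  then have "pcompose (pderiv (pderiv W) + pderiv (wave_h a) * pderiv W
      + ([:b:] - of_nat n * [:0, 1:]) * W) m = 0"
    by simp
  moreover have "pcompose (pderiv (wave_h a)) m = pderiv (wave_h a)"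
    by (simp add: m_def pderiv_wave_h pcompose_pCons)
  moreover have "pcompose ([:b:] - of_nat n * [:0, 1:]) m = [:b, of_nat n:]"
    by (simp add: m_def of_nat_poly pcompose_pCons pcompose_diff)
  ultimately have "wave_eq a n b y"
    by (simp add: wave_eq_def y_def pderiv_pcompose m pderiv_minus pcompose_add pcompose_mult
        del: mult_pCons_left)
  obtain s where s: "w * to_fract (p ^ Suc n) = to_fract s" "degree s = (n + 2) * n" "lead_coeff s = 1"
    using wave_rem_denominator[OF p, of n] unfolding w_def by blast
  then have "to_fract (W * p ^ Suc n) = to_fract s"
    by (simp only: W to_fract_mult)
  then have Ws: "W * p ^ Suc n = s"
    by (simp only: to_fract_eq_iff)
  have "s \<noteq> 0"
    using s(3) by auto
  with Ws have "W \<noteq> 0"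
    by auto
  have "degree W + Suc n * n = (n + 2) * n"
    using s(2) \<open>W \<noteq> 0\<close> p0 deg unfolding Ws[symmetric]
    by (subst (asm) degree_mult_eq) (simp_all add: degree_power_eq del: power_Suc)
  then have degW: "degree W = n"
    by simp
  have "lead_coeff W = 1"
    using s(3) p(2) unfolding Ws[symmetric] lead_coeff_mult lead_coeff_power by simp
  then have "coeff y n = (-1) ^ n"
    using degW by (simp add: y_def m_def coeff_pcompose_linear)
  then have "y = smult ((-1) ^ n) p"
    using p(2) deg by (intro wave_eq_unique[OF wave_eq_smult[OF p(1)] \<open>wave_eq a n b y\<close>]) simp
  then have "pcompose y m = smult ((-1) ^ n) (pcompose p m)"
    by (simp add: pcompose_smult)
  moreover have "pcompose y m = W"
    by (simp add: y_def m flip: pcompose_assoc)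
  ultimately have "W = smult ((-1) ^ n) (pcompose p [:0, -1:])"
    by (simp add: m_def)
  then show ?thesis
    using W unfolding w_def by (simp only:)
qed

section \<open>Integration by parts\<close>

text \<open>\<open>wave_D\<close> is differentiation conjugated by \<open>exp h\<close>, so this
  product rule is integration by parts modulo its image.\<close>

lemma wave_D_to_fract_mult: "wave_D a (to_fract f * q) = to_fract (pderiv f) * q + to_fract f * wave_D a q"
  by (simp add: wave_D_def fract_deriv_mult algebra_simps)

lemma pderiv_minus_one_power: "pderiv ((-1) ^ j) = (0 :: complex poly)"
  by (cases "even j") (simp_all add: pderiv_minus)

text \<open>The derivative telescopes to boundary terms containing an \<open>(n + 1)\<close>-st
  derivative of \<open>p\<close> or \<open>q\<close>, which vanish; the constant is read off at
  0.\<close>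

lemma alternating_leibniz_sum_const:
  fixes p q :: "complex poly"
  assumes "degree p \<le> n" and "degree q \<le> n"
  shows "(\<Sum>j\<le>n. (-1) ^ j * (pderiv ^^ j) q * (pderiv ^^ (n - j)) p)
    = [:\<Sum>j\<le>n. (-1) ^ j * (fact j * coeff q j) * (fact (n - j) * coeff p (n - j)):]" (is "?S = [:?c:]")
proof -
  define T where "T j = (-1) ^ j * (pderiv ^^ j) q * (pderiv ^^ (Suc n - j)) p" for j
  have "pderiv ?S = (\<Sum>j\<le>n. T j - T (Suc j))"
    unfolding higher_pderiv_sum[of 1, simplified]
    by (intro sum.cong)
      (auto simp: T_def pderiv_mult pderiv_minus_one_power Suc_diff_le algebra_simps)
  also have "\<dots> = T 0 - T (Suc n)"
    by (rule sum_telescope)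
  also have "\<dots> = 0"
    using higher_pderiv_degree_Suc[of p n] higher_pderiv_degree_Suc[of q n] assms
    by (simp add: T_def del: funpow.simps)
  finally have "degree ?S = 0"
    by (simp only: pderiv_eq_0_iff)
  then have "?S = [:coeff ?S 0:]"
    by (rule degree_0_id[symmetric])
  also have "coeff ?S 0 = ?c"
  proof -
    have "coeff ((-1) ^ j) 0 = ((-1) ^ j :: complex)" for j
      by (cases "even j") simp_all
    then show ?thesis
      by (simp add: coeff_sum coeff_mult_0 coeff_higher_pderiv flip: pochhammer_fact)
  qed
  finally show ?thesis .
qed

text \<open>The alternating sum \<open>S\<close> is the primitive produced by repeated integration
  by parts. In \<open>wave_D a S\<close> the remainders telescope to \<open>(-1) ^ n\<close> times
  \<open>q^2\<close>, and the rest is a constant Leibniz sum over \<open>p^2\<close>.\<close>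

lemma wave_sim_reflected_square:
  assumes p: "wave_eq a n b p" "lead_coeff p = 1"
  shows "wave_sim a (to_fract ((pcompose p [:0, -1:])\<^sup>2))
    (to_fract [:(-1) ^ n * (\<Sum>j\<le>n. (fact j * coeff p j) * (fact (n - j) * coeff p (n - j))):]
      / to_fract (p\<^sup>2))"
proof -
  from p(2) have p0: "p \<noteq> 0"
    by auto
  with p have deg: "degree p = n"
    by (intro degree_wave_eq)
  define q where "q = pcompose p [:0, -1:]"
  define r where "r = wave_rem a p"
  define Q where "Q j = to_fract ((-1) ^ j * (pderiv ^^ j) q)" for j
  define P where "P j = to_fract ((pderiv ^^ j) p)" for j
  define T where "T j = Q j * r (Suc n - j)" for j
  define S where "S = (\<Sum>j\<le>n. Q j * r (n - j))"
  define K where "K = (\<Sum>j\<le>n. (fact j * coeff p j) * (fact (n - j) * coeff p (n - j)))"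
  have degq: "degree q = n"
    using deg by (simp add: q_def degree_pcompose)
  have D: "wave_D a (Q j * r (n - j)) = T j - T (Suc j) - Q j * P (n - j) / to_fract (p\<^sup>2)"
    if "j \<le> n" for j
  proof -
    have "r (Suc n - j) = wave_D a (r (n - j)) + P (n - j) / to_fract (p\<^sup>2)"
      using that by (simp add: r_def P_def Suc_diff_le)
    moreover have "to_fract (pderiv ((-1) ^ j * (pderiv ^^ j) q)) = - Q (Suc j)"
      by (simp add: Q_def pderiv_mult pderiv_minus_one_power)
    ultimately show ?thesis
      unfolding T_def Q_def[of j] wave_D_to_fract_mult by (simp add: algebra_simps)
  qed
  have "wave_D a S = (\<Sum>j\<le>n. T j - T (Suc j)) - (\<Sum>j\<le>n. Q j * P (n - j)) / to_fract (p\<^sup>2)"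
    by (simp add: S_def wave_D_sum D sum_subtractf sum_divide_distrib)
  also have "(\<Sum>j\<le>n. T j - T (Suc j)) = T 0 - T (Suc n)"
    by (rule sum_telescope)
  \<comment> \<open>\<open>T (Suc n)\<close> contains the factor
    \<open>wave_rem a p 0 = 0\<close>.\<close>
  also have "\<dots> = to_fract q * to_fract (smult ((-1) ^ n) q)"
    using wave_rem_Suc_degree[OF p] by (simp add: T_def Q_def r_def q_def del: wave_rem.simps(2))
  also have "(\<Sum>j\<le>n. Q j * P (n - j))
      = to_fract (\<Sum>j\<le>n. (-1) ^ j * (pderiv ^^ j) q * (pderiv ^^ (n - j)) p)"
    by (simp add: Q_def P_def)
  also have "\<dots> = to_fract [:K:]"
  proof -
    \<comment> \<open>The signs in the coefficients of \<open>p(-x)\<close> cancel those of the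
      integration by parts.\<close>
    have "(-1) ^ j * (fact j * ((-1) ^ j * x)) = fact j * x" for j and x :: complex
      by (cases "even j") simp_all
    then show ?thesis
      using alternating_leibniz_sum_const[of p n q] deg degq
      by (simp only: K_def q_def coeff_pcompose_linear order_refl)
  qed
  finally have S: "wave_D a S = to_fract q * to_fract (smult ((-1) ^ n) q) - to_fract [:K:] / to_fract (p\<^sup>2)" .
  have "wave_D a (to_fract [:(-1) ^ n:] * S) = to_fract [:(-1) ^ n:] * wave_D a S"
    unfolding wave_D_to_fract_mult by (simp add: pderiv_pCons)
  also have "\<dots> = to_fract ([:(-1) ^ n:] * (q * smult ((-1) ^ n) q))
      - to_fract ([:(-1) ^ n:] * [:K:]) / to_fract (p\<^sup>2)"
    unfolding S to_fract_mult by (simp add: right_diff_distrib del: to_fract_mult)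
  also have "[:(-1) ^ n:] * (q * smult ((-1) ^ n) q) = q\<^sup>2"
  proof -
    have "(-1) ^ n * (-1) ^ n = (1 :: complex)"
      by (simp flip: power_mult_distrib)
    then show ?thesis
      by (simp add: power2_eq_square)
  qed
  also have "[:(-1) ^ n:] * [:K:] = [:(-1) ^ n * K:]"
    by simp
  finally have "wave_D a (to_fract [:(-1) ^ n:] * S)
      = to_fract (q\<^sup>2) - to_fract [:(-1) ^ n * K:] / to_fract (p\<^sup>2)" .
  from this[symmetric] show ?thesis
    unfolding wave_sim_def q_def[symmetric] K_def[symmetric] by (rule range_eqI)
qed

section \<open>The derivative of the determinant\<close>

lemma det_upper_triangular_prod:
  "A \<in> carrier_mat m m \<Longrightarrow> upper_triangular A \<Longrightarrow> det A = (\<Prod>i = 0..<m. A $$ (i, i))"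
  using det_upper_triangular[of A m] by (simp add: prod_list_diag_prod)

text \<open>Right multiplication by the identity with last column \<open>v\<close>, of determinant
  \<open>v n\<close>, turns the last column of \<open>A\<close> into \<open>t\<close> times
  \<open>v\<close>, from which \<open>t\<close> factors out.\<close>

lemma det_mult_eigenvector:
  fixes A :: "'a::comm_ring_1 mat"
  assumes A: "A \<in> carrier_mat (Suc n) (Suc n)"
    and v: "\<And>i. i \<le> n \<Longrightarrow> (\<Sum>k = 0..<Suc n. A $$ (i, k) * v k) = t * v i"
  shows "det A * v n
    = t * det (Matrix.mat (Suc n) (Suc n) (\<lambda>(i, j). if j = n then v i else A $$ (i, j)))"
proof -
  define E where "E = Matrix.mat (Suc n) (Suc n)
    (\<lambda>(i, j). if j = n then v i else if i = j then 1 else 0)"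
  define N where "N = Matrix.mat (Suc n) (Suc n) (\<lambda>(i, j). if j = n then v i else A $$ (i, j))"
  define T where "T = Matrix.mat (Suc n) (Suc n)
    (\<lambda>(i, j). if i = j then if j = n then t else 1 else 0)"
  have car: "E \<in> carrier_mat (Suc n) (Suc n)" "N \<in> carrier_mat (Suc n) (Suc n)"
      "T \<in> carrier_mat (Suc n) (Suc n)"
    by (simp_all add: E_def N_def T_def)
  have "upper_triangular E" "upper_triangular T"
    by (auto simp: E_def T_def)
  with car have "det E = (\<Prod>i = 0..<Suc n. E $$ (i, i))" "det T = (\<Prod>i = 0..<Suc n. T $$ (i, i))"
    using det_upper_triangular_prod by blast+
  then have "det E = v n" "det T = t"
    by (simp_all add: E_def T_def)
  moreover have "A * E = N * T"
  proof (rule eq_matI)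
    fix i j assume "i < dim_row (N * T)" "j < dim_col (N * T)"
    then have i: "i < Suc n" and j: "j < Suc n"
      using car by simp_all
    have "(A * E) $$ (i, j) = (\<Sum>k = 0..<Suc n. A $$ (i, k) * E $$ (k, j))"
      using i j A car by (simp add: scalar_prod_def)
    also have "\<dots> = (\<Sum>k = 0..<Suc n. if j = n then A $$ (i, k) * v k else if k = j then A $$ (i, k) else 0)"
      using j by (intro sum.cong) (auto simp: E_def)
    also have "\<dots> = (if j = n then t * v i else A $$ (i, j))"
      using i j v[of i] by simp
    also have "\<dots> = (\<Sum>k = 0..<Suc n. if k = j then N $$ (i, k) * T $$ (k, j) else 0)"
      using i j by (simp add: N_def T_def)
    also have "\<dots> = (\<Sum>k = 0..<Suc n. N $$ (i, k) * T $$ (k, j))"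
      using j by (intro sum.cong) (auto simp: T_def)
    also have "\<dots> = (N * T) $$ (i, j)"
      using i j car by (simp add: scalar_prod_def)
    finally show "(A * E) $$ (i, j) = (N * T) $$ (i, j)" .
  qed (use A car in simp_all)
  then have "det A * det E = det N * det T"
    using A car by (metis det_mult)
  ultimately show ?thesis
    by (simp add: N_def mult.commute)
qed

text \<open>Left multiplication by the identity with first row \<open>w\<close> leaves only the
  corner entry in the first row. Its minor is upper triangular, with the subdiagonal of
  \<open>N\<close> as its diagonal. The last column is exempt from the hypothesis on
  \<open>w\<close> since it will hold the right kernel vector.\<close>

lemma det_hessenberg_left_kernel:
  fixes N :: "'a::comm_ring_1 mat"
  assumes N: "N \<in> carrier_mat (Suc n) (Suc n)"
    and hess: "\<And>i j. i \<le> n \<Longrightarrow> Suc j < i \<Longrightarrow> N $$ (i, j) = 0"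
    and w: "\<And>j. j < n \<Longrightarrow> (\<Sum>i = 0..<Suc n. w i * N $$ (i, j)) = 0"
  shows "w 0 * det N
    = (-1) ^ n * (\<Sum>i = 0..<Suc n. w i * N $$ (i, n)) * (\<Prod>k = 0..<n. N $$ (Suc k, k))"
proof -
  define F where "F = Matrix.mat (Suc n) (Suc n)
    (\<lambda>(i, j). if i = 0 then w j else if i = j then 1 else 0)"
  define c where "c = (\<Sum>i = 0..<Suc n. w i * N $$ (i, n))"
  define R where "R = Matrix.mat (Suc n) (Suc n)
    (\<lambda>(i, j). if i = 0 then if j = n then c else 0 else N $$ (i, j))"
  have car: "F \<in> carrier_mat (Suc n) (Suc n)" "R \<in> carrier_mat (Suc n) (Suc n)"
    by (simp_all add: F_def R_def)
  have "upper_triangular F"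
    by (auto simp: F_def)
  then have "det F = (\<Prod>i = 0..<Suc n. F $$ (i, i))"
    using car by (simp add: det_upper_triangular_prod)
  also have "\<dots> = w 0"
    by (subst prod.atLeast0_lessThan_Suc_shift) (simp add: F_def)
  finally have F: "det F = w 0" .
  have "F * N = R"
  proof (rule eq_matI)
    fix i j assume "i < dim_row R" "j < dim_col R"
    then have i: "i < Suc n" and j: "j < Suc n"
      using car by simp_all
    have "(F * N) $$ (i, j) = (\<Sum>k = 0..<Suc n. F $$ (i, k) * N $$ (k, j))"
      using i j N car by (simp add: scalar_prod_def)
    also have "\<dots> = (\<Sum>k = 0..<Suc n. if i = 0 then w k * N $$ (k, j) else if i = k then N $$ (k, j) else 0)"
      using i by (intro sum.cong) (auto simp: F_def)
    also have "\<dots> = R $$ (i, j)"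
      using i j w[of j] by (auto simp: R_def c_def)
    finally show "(F * N) $$ (i, j) = R $$ (i, j)" .
  qed (use N car in simp_all)
  then have "w 0 * det N = det R"
    using F det_mult[OF car(1) N] by simp
  also have "\<dots> = (\<Sum>j<Suc n. R $$ (0, j) * cofactor R 0 j)"
    using car(2) by (rule laplace_expansion_row) simp
  also have "\<dots> = (\<Sum>j<Suc n. if j = n then c * cofactor R 0 n else 0)"
    by (intro sum.cong) (auto simp: R_def)
  also have "\<dots> = c * ((-1) ^ n * det (mat_delete R 0 n))"
    by (simp add: cofactor_def)
  also have "det (mat_delete R 0 n) = (\<Prod>k = 0..<n. N $$ (Suc k, k))"
  proof -
    have "mat_delete R 0 n \<in> carrier_mat n n"
      using mat_delete_carrier[OF car(2)] by simp
    moreover have "upper_triangular (mat_delete R 0 n)"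
      by (auto simp: mat_delete_def R_def hess)
    ultimately have "det (mat_delete R 0 n) = (\<Prod>k = 0..<n. mat_delete R 0 n $$ (k, k))"
      by (rule det_upper_triangular_prod)
    also have "\<dots> = (\<Prod>k = 0..<n. N $$ (Suc k, k))"
      by (intro prod.cong) (auto simp: mat_delete_def R_def)
    finally show ?thesis .
  qed
  finally show ?thesis
    by (simp add: c_def mult_ac)
qed

section \<open>The matrix of the operator and its symmetry\<close>

definition wave_mat :: "complex \<Rightarrow> nat \<Rightarrow> complex \<Rightarrow> complex mat" where
  "wave_mat a n z = poly_op_mat n (\<lambda>f. wave_op a n f + smult z f)"

lemma wave_mat_carrier: "wave_mat a n z \<in> carrier_mat (Suc n) (Suc n)"
  by (simp add: wave_mat_def poly_op_mat_def)

lemma wave_mat_index: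
  assumes "i \<le> n" and "j \<le> n"
  shows "wave_mat a n z $$ (i, j) = (if i = j then z else 0)
    + (if j = i + 2 then 1 else if j = i + 1 then - a
       else if i = j + 1 then of_nat (n - j) * of_nat (j + 1) else 0)"
proof -
  have e: "coeff (exp_basis j) k = (if k = j then 1 / fact k else 0)" for k
    by (simp add: exp_basis_def)
  have M: "wave_mat a n z $$ (i, j) = fact i * coeff (wave_op a n (exp_basis j)) i
      + fact i * (z * coeff (exp_basis j) i)"
    using assms by (simp add: wave_mat_def poly_op_mat_def algebra_simps)
  consider "j = Suc (Suc i)" | "j = Suc i" | "j = i" | "i = Suc j"
    | "j \<noteq> Suc (Suc i)" "j \<noteq> Suc i" "j \<noteq> i" "i \<noteq> Suc j"
    by blast
  then show ?thesis
  proof cases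
    case 1
    have "(fact (Suc (Suc i)) :: complex) = of_nat ((i + 1) * (i + 2)) * fact i"
      by (simp add: algebra_simps)
    moreover have "(fact (Suc (Suc i)) :: complex) \<noteq> 0"
      by (rule fact_nonzero)
    ultimately show ?thesis
      unfolding M coeff_wave_op e using 1 by (simp del: fact_Suc)
  next
    case 2
    have shift: "i - Suc 0 \<noteq> Suc i"
      by simp
    have "(fact (Suc i) :: complex) = of_nat (i + 1) * fact i"
      by (simp add: algebra_simps)
    moreover have "(fact (Suc i) :: complex) \<noteq> 0"
      by (rule fact_nonzero)
    ultimately show ?thesis
      unfolding M coeff_wave_op e using 2 shift by (simp del: fact_Suc)
  next
    case 3
    have "i - Suc 0 = i \<longleftrightarrow> i = 0"
      by auto
    with 3 show ?thesis
      unfolding M coeff_wave_op e by simp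
  next
    case 4
    then show ?thesis
      unfolding M coeff_wave_op e using assms by (simp add: of_nat_diff algebra_simps)
  next
    case 5
    then show ?thesis
      unfolding M coeff_wave_op e by auto
  qed
qed

text \<open>\<open>p\<close> is an eigenvector of the shifted operator with eigenvalue
  \<open>z - b\<close>, and \<open>fact k * coeff p k\<close> are its coordinates in
  \<open>exp_basis\<close>.\<close>

lemma wave_mat_mult_coeffs:
  assumes p: "wave_eq a n b p" and deg: "degree p \<le> n" and i: "i \<le> n"
  shows "(\<Sum>k = 0..<Suc n. wave_mat a n z $$ (i, k) * (fact k * coeff p k))
    = (z - b) * (fact i * coeff p i)"
proof -
  define L where "L f = wave_op a n f + smult z f" for f
  have add: "L (f + g) = L f + L g" and smult: "L (smult c f) = smult c (L f)" for f g c
    by (simp_all add: L_def wave_op_def pderiv_add pderiv_smult smult_add_right smult_diff_right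
        mult.commute algebra_simps)
  have zero: "L 0 = 0"
    by (simp add: L_def wave_op_def)
  have sum: "L (sum f A) = (\<Sum>k\<in>A. L (f k))" if "finite A" for f and A :: "nat set"
    using that by (induction A rule: finite_induct) (simp_all add: add zero)
  have "L p = (\<Sum>k\<le>n. smult (fact k * coeff p k) (L (exp_basis k)))"
    by (subst exp_basis_expansion[OF deg]) (simp add: sum smult)
  moreover have "L p = smult (z - b) p"
    using p by (simp add: L_def wave_op_def wave_eq_def smult_diff_left algebra_simps)
  ultimately have "fact i * coeff (smult (z - b) p) i
      = fact i * coeff (\<Sum>k\<le>n. smult (fact k * coeff p k) (L (exp_basis k))) i"
    by simp
  also have "\<dots> = (\<Sum>k\<le>n. wave_mat a n z $$ (i, k) * (fact k * coeff p k))"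
    unfolding coeff_sum sum_distrib_left
    using i by (intro sum.cong) (auto simp: wave_mat_def poly_op_mat_def L_def)
  finally show ?thesis
    by (simp add: atLeast0LessThan lessThan_Suc_atMost mult_ac)
qed

text \<open>The factorial scaling of the basis makes every diagonal constant except the subdiagonal,
  whose entries \<open>(n - j) (j + 1)\<close> are invariant under
  \<open>j \<mapsto> n - 1 - j\<close>. Hence reversing a right kernel vector gives a left
  one.\<close>

lemma wave_mat_persymmetric:
  assumes "i \<le> n" and "j \<le> n"
  shows "wave_mat a n z $$ (i, j) = wave_mat a n z $$ (n - j, n - i)"
proof -
  have "n - j = n - i \<longleftrightarrow> i = j" "n - i = n - j + 2 \<longleftrightarrow> j = i + 2"
      "n - i = n - j + 1 \<longleftrightarrow> j = i + 1" "n - j = n - i + 1 \<longleftrightarrow> i = j + 1"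
    using assms by arith+
  moreover have "n - (n - i) = j + 1" "n - i + 1 = n - j" if "i = j + 1"
    using assms that by arith+
  ultimately show ?thesis
    unfolding wave_mat_index[OF assms] wave_mat_index[OF diff_le_self diff_le_self]
    by (simp only: mult.commute cong: if_cong)
qed

lemma continuous_det:
  fixes A :: "complex \<Rightarrow> complex mat"
  assumes "\<And>z. A z \<in> carrier_mat m m"
    and "\<And>i j. i < m \<Longrightarrow> j < m \<Longrightarrow> isCont (\<lambda>z. A z $$ (i, j)) b"
  shows "isCont (\<lambda>z. det (A z)) b"
proof -
  have "isCont (\<lambda>z. \<Sum>p | p permutes {0..<m}. signof p * (\<Prod>i = 0..<m. A z $$ (i, p i))) b"
    using assms(2) by (intro continuous_intros) (auto dest: permutes_in_image)
  then show ?thesis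
    by (simp add: det_def'[OF assms(1)])
qed

text \<open>Replacing the last column by the coordinate vector of \<open>p\<close> splits off the factor \<open>z - b\<close>, and
  then replacing the first row at \<open>z = b\<close> by its pairing with the left kernel leaves only one
  term in the Laplace expansion.\<close>
lemma deriv_det_wave_mat:
  assumes p: "wave_eq a n b p" and deg: "degree p = n" and monic: "lead_coeff p = 1"
  shows "((\<lambda>z. det (wave_mat a n z)) has_field_derivative
    (-1) ^ n * (\<Sum>j\<le>n. (fact j * coeff p j) * (fact (n - j) * coeff p (n - j)))) (at b)"
proof -
  define v where "v i = fact i * coeff p i" for i
  define N where "N z = Matrix.mat (Suc n) (Suc n)
    (\<lambda>(i, j). if j = n then v i else wave_mat a n z $$ (i, j))" for z
  have N: "N z \<in> carrier_mat (Suc n) (Suc n)" for z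
    by (simp add: N_def)
  have vn: "v n = fact n"
    using monic deg by (simp add: v_def)
  have kernel: "(\<Sum>k = 0..<Suc n. wave_mat a n z $$ (i, k) * v k) = (z - b) * v i" if "i \<le> n" for i z
    unfolding v_def using wave_mat_mult_coeffs[OF p] deg that by simp
  have det: "det (wave_mat a n z) = (z - b) * (det (N z) / fact n)" for z
    using det_mult_eigenvector[where v = v, OF wave_mat_carrier kernel, of z]
    by (simp add: vn N_def eq_divide_eq)
  have "isCont (\<lambda>z. det (N z)) b"
  proof (rule continuous_det[OF N])
    fix i j assume "i < Suc n" "j < Suc n"
    then show "isCont (\<lambda>z. N z $$ (i, j)) b"
      by (cases "j = n"; cases "i = j") (simp_all add: N_def wave_mat_index)
  qed
  then have "isCont (\<lambda>z. det (N z) / fact n) b"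
    by (rule isCont_divide) simp_all
  \<comment> \<open>Caratheodory's criterion: the cofactor of \<open>z - b\<close> is continuous at
    \<open>b\<close>, and its value there is the derivative.\<close>
  then have deriv: "((\<lambda>z. det (wave_mat a n z)) has_field_derivative det (N b) / fact n) (at b)"
    unfolding CARAT_DERIV by (intro exI[of _ "\<lambda>z. det (N z) / fact n"]) (simp add: det)
  \<comment> \<open>The left kernel vector is the reversed \<open>v\<close>. Its first entry
    \<open>v n = fact n\<close>, together with the \<open>fact n\<close> dividing
    \<open>det (N b)\<close>, cancels the subdiagonal product
    \<open>fact n * fact n\<close>.\<close>
  have "v (n - 0) * det (N b) = (-1) ^ n * (\<Sum>i = 0..<Suc n. v (n - i) * N b $$ (i, n))
      * (\<Prod>k = 0..<n. N b $$ (Suc k, k))"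
  proof (rule det_hessenberg_left_kernel[OF N, where w = "\<lambda>i. v (n - i)"])
    show "N b $$ (i, j) = 0" if "i \<le> n" "Suc j < i" for i j
      using that by (simp add: N_def wave_mat_index)
    \<comment> \<open>By the antidiagonal symmetry, pairing column \<open>j\<close> with the
      reversed \<open>v\<close> amounts to applying row \<open>n - j\<close> to
      \<open>v\<close>.\<close>
    fix j assume j: "j < n"
    have "(\<Sum>i = 0..<Suc n. v (n - i) * N b $$ (i, j))
        = (\<Sum>i = 0..<Suc n. v (n - i) * wave_mat a n b $$ (n - j, n - i))"
      using j by (intro sum.cong) (auto simp: N_def wave_mat_persymmetric[of _ n j])
    also have "\<dots> = (\<Sum>k = 0..<Suc n. wave_mat a n b $$ (n - j, k) * v k)"
      by (rule sum.reindex_bij_witness[of _ "\<lambda>k. n - k" "\<lambda>k. n - k"]) (auto simp: mult.commute)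
    also have "\<dots> = 0"
      using kernel[of "n - j" b] by simp
    finally show "(\<Sum>i = 0..<Suc n. v (n - i) * N b $$ (i, j)) = 0" .
  qed
  also have "(\<Sum>i = 0..<Suc n. v (n - i) * N b $$ (i, n)) = (\<Sum>j\<le>n. v j * v (n - j))"
    unfolding atLeast0LessThan lessThan_Suc_atMost
    by (intro sum.cong) (auto simp: N_def mult.commute)
  also have "(\<Prod>k = 0..<n. N b $$ (Suc k, k)) = (\<Prod>k = 0..<n. of_nat (n - k) * of_nat (Suc k))"
    by (intro prod.cong) (auto simp: N_def wave_mat_index)
  also have "\<dots> = fact n * fact n"
    using fact_prod_rev[of n, where 'a = complex] fact_prod_Suc[of n, where 'a = complex]
    by (simp only: prod.distrib of_nat_prod)
  finally have "det (N b) / fact n = (-1) ^ n * (\<Sum>j\<le>n. v j * v (n - j))"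
    using vn by (simp add: field_simps)
  with deriv show ?thesis
    by (simp add: v_def)
qed

theorem corollary7p2:
  fixes a b :: complex and n :: nat and p :: "complex poly"
  assumes "wave_polynomial a n p"
    and "lead_coeff p = 1"
    and "wave_eq a n b p"
  defines "c \<equiv> deriv (\<lambda>z. poly_op_det n (\<lambda>f. wave_op a n f + smult z f)) b"
  shows "wave_sim a (to_fract ((pcompose p [:0, -1:])\<^sup>2)) (to_fract [:c:] / to_fract (p\<^sup>2))"
proof -
  have "degree p = n"
    using assms(1,3) by (intro degree_wave_eq) (auto simp: wave_polynomial_def)
  then have "c = (-1) ^ n * (\<Sum>j\<le>n. (fact j * coeff p j) * (fact (n - j) * coeff p (n - j)))"
    unfolding c_def poly_op_det_def wave_mat_def[symmetric]
    using assms(2,3) by (intro DERIV_imp_deriv deriv_det_wave_mat)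
  then show ?thesis
    using wave_sim_reflected_square[OF assms(3,2)] by simp
qed

end
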